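(* Let $k\ge 1$ be an integer. The Lucas number $L_k$ can be written as a product of three repdigits (in base $10$), i.e. $$L_k=d_1\frac{10^\ell-1}{9}\cdot d_2\frac{10^m-1}{9}\cdot d_3\frac{10^n-1}{9}$$ for some integers $1\le d_1,d_2,d_3\le 9$ and $1\le \ell\le m\le n$, if and only if $L_k\in\{1,3,4,7,11,18\}$.
   Context: $(L_n)_{n\ge 0}$ is the Lucas sequence: $L_0=2$, $L_1=1$, $L_{n+2}=L_{n+1}+L_n$. A repdigit is a positive integer all of whose decimal digits are equal, i.e. a number $d\frac{10^m-1}{9}$ with $m\ge 1$, $1\le d\le 9$. *)

theory Defs
  imports Main
begin

fun lucas :: "nat \<Rightarrow> nat" where
  "lucas 0 = 2"
| "lucas (Suc 0) = 1"
| "lucas (Suc (Suc n)) = lucas (Suc n) + lucas n"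

definition repdigit :: "nat \<Rightarrow> nat \<Rightarrow> nat" where
  "repdigit d m = d * ((10 ^ m - 1) div 9)"

end

theory Submission
  imports Defs "HOL-Number_Theory.Number_Theory"
begin

text \<open>
  Linear forms in logarithms are not needed: congruences and quadratic reciprocity suffice.
  Let at least one of the repunits \<open>R\<^sub>n = (10\<^sup>n - 1) / 9\<close> involved have \<open>n \<ge> 2\<close>, so
  \<open>R\<^sub>n \<equiv> 11\<close> modulo 100. If \<open>k\<close> is even, then \<open>L\<^sub>k\<^sup>2 = 5 F\<^sub>k\<^sup>2 + 4\<close>, so \<open>-5\<close> is a square modulo
  every prime divisor of \<open>L\<^sub>k\<close> prime to 10, and hence every divisor of \<open>L\<^sub>k\<close> prime to 10 is
  1, 3, 7 or 9 modulo 20, whereas \<open>R\<^sub>n \<equiv> 11\<close>. If \<open>k\<close> is odd, then \<open>L\<^sub>k\<close> is divisible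
  by none of 3, 5, 7, 8, so the product of the digits is 1, 2 or 4; the residues of \<open>L\<^sub>k\<close>
  modulo 25 and 16 then leave \<open>L\<^sub>k = R\<^sub>n\<close>, which modulo 8 forces \<open>n = 2\<close>, and
  \<open>L\<^sub>k = R\<^sub>m R\<^sub>n\<close> with \<open>m, n \<ge> 2\<close>, which is impossible modulo 11.
\<close>

section \<open>Divisors of \<open>5x\<^sup>2 + 4\<close>\<close>

lemma Legendre_5:
  "Legendre a 5 = (if a mod 5 = 0 then 0 else if a mod 5 \<in> {1, 4} then 1 else -1)"
proof -
  have "QuadRes 5 a \<longleftrightarrow> a mod 5 \<in> {0, 1, 4}"
  proof
    assume "QuadRes 5 a"
    then obtain y where y: "y\<^sup>2 mod 5 = a mod 5"
      by (auto simp: QuadRes_def cong_def)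
    have "y mod 5 \<in> {0, 1, 2, 3, 4}" by auto
    moreover have "y\<^sup>2 mod 5 = (y mod 5)\<^sup>2 mod 5" by (simp add: power_mod)
    ultimately show "a mod 5 \<in> {0, 1, 4}" using y by auto
  next
    assume "a mod 5 \<in> {0, 1, 4}"
    then have "\<exists>y\<in>{0, 1, 2 :: int}. y\<^sup>2 mod 5 = a mod 5" by auto
    then show "QuadRes 5 a" unfolding QuadRes_def cong_def by blast
  qed
  then show ?thesis by (auto simp: Legendre_def cong_def)
qed

text \<open>Raising \<open>5x^2 = -2^2\<close> to the power \<open>h = (p - 1) / 2\<close> gives
  \<open>5^h = (-1)^h\<close> modulo \<open>p\<close> by Fermat. Euler's criterion and reciprocity
  turn this into \<open>(p/5) = (-1)^h\<close>, which ties \<open>p mod 5\<close> to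
  \<open>p mod 4\<close>.\<close>

lemma prime_dvd_5_square_plus_4:
  fixes p x :: nat
  assumes p: "prime p" "p \<noteq> 2" "p \<noteq> 5" and dvd: "p dvd 5 * x\<^sup>2 + 4"
  shows "p mod 20 \<in> {1, 3, 7, 9}"
proof -
  define h where "h = (p - 1) div 2"
  have p2: "p > 2" using p prime_ge_2_nat[of p] by simp
  have odd: "odd p" using p(1) p2 prime_odd_nat by blast
  have h2: "p - 1 = 2 * h" using odd by (auto simp: h_def elim!: oddE)
  have n2: "\<not> p dvd 2" using p2 by (auto dest: dvd_imp_le)
  have nx: "\<not> p dvd x"
  proof
    assume "p dvd x"
    then have "p dvd 5 * x\<^sup>2" by (simp add: power2_eq_square)
    with dvd have "p dvd 4" by (simp add: dvd_add_right_iff)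
    then have "p dvd 2 ^ 2" by simp
    then show False using n2 p(1) prime_dvd_power by blast
  qed
  have fermat: "[int y ^ (2 * h) = 1] (mod int p)" if "\<not> p dvd y" for y
    using fermat_theorem[OF p(1) that] h2
    by (metis cong_int_iff of_nat_1 of_nat_power)
  have "[5 * int x ^ 2 = - (2 ^ 2)] (mod int p)"
    using dvd by (auto simp: cong_iff_dvd_diff simp flip: int_dvd_int_iff)
  then have "[(5 * int x ^ 2) ^ h = (- (2 ^ 2)) ^ h] (mod int p)"
    by (rule cong_pow)
  also have "(- (2 ^ 2)) ^ h = (-1) ^ h * (2 :: int) ^ (2 * h)"
    by (subst power_minus) (simp add: power_mult)
  also have "[\<dots> = (-1) ^ h * 1] (mod int p)"
    using fermat[OF n2] by (intro cong_mult) auto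
  finally have A: "[5 ^ h * int x ^ (2 * h) = (-1) ^ h] (mod int p)"
    by (simp add: power_mult_distrib power_mult)
  have "[5 ^ h * int x ^ (2 * h) = 5 ^ h * 1] (mod int p)"
    using fermat[OF nx] by (intro cong_mult) auto
  with A have B: "[5 ^ h = (-1) ^ h] (mod int p)"
    by (metis cong_sym cong_trans mult.right_neutral)
  have "[Legendre 5 (int p) = 5 ^ h] (mod int p)"
    using euler_criterion[OF p(1) p2, of 5] by (simp add: h_def)
  with B have C: "[Legendre 5 (int p) = (-1) ^ h] (mod int p)"
    by (rule cong_trans[rotated])
  have "Legendre 5 (int p) = (-1) ^ h"
  proof -
    \<comment> \<open>Both terms lie in {-1, 0, 1}, so their difference is smaller than
      \<open>p\<close> and the congruence is an equality.\<close>
    have "\<bar>Legendre 5 (int p) - (-1) ^ h\<bar> \<le> 2"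
      by (cases "even h") (auto simp: Legendre_def)
    moreover have "int p dvd Legendre 5 (int p) - (-1) ^ h"
      using C by (simp add: cong_iff_dvd_diff)
    ultimately show ?thesis
      using p2 dvd_imp_le_int[of "Legendre 5 (int p) - (-1) ^ h" "int p"] by fastforce
  qed
  \<comment> \<open>The exponent of -1 in the reciprocity law is \<open>2 * h\<close>, hence
    even.\<close>
  moreover have "Legendre (int p) (int 5) * Legendre (int 5) (int p) = 1"
    using Quadratic_Reciprocity[OF p(1) p2, of 5] p(3)
    by (simp add: power_mult power_mult_distrib[symmetric] flip: h_def)
      (simp flip: power_mult add: mult.commute)
  ultimately have "Legendre (int p) 5 = (-1) ^ h"
    by (cases "even h") auto
  then have L: "if even h then int p mod 5 \<in> {1, 4} else int p mod 5 \<in> {2, 3}"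
    unfolding Legendre_5 by (auto split: if_splits)
  have "int p mod 5 = int (p mod 5)" by (simp add: zmod_int)
  then have L': "if even h then p mod 5 \<in> {1, 4} else p mod 5 \<in> {2, 3}"
    using L by (auto split: if_splits)
  have ph: "p = 2 * h + 1" using h2 p2 by simp
  have mods: "(p mod 20) mod 4 = p mod 4" "(p mod 20) mod 5 = p mod 5"
    by (simp_all add: mod_mod_cancel)
  have "p mod 20 \<in> {..<20}" by simp
  then have residues: "p mod 20 \<in> {0, 1, 2, 3, 4, 5, 6, 7, 8, 9, 10, 11, 12, 13, 14, 15, 16, 17, 18, 19}"
    by (simp add: lessThan_nat_numeral lessThan_Suc insert_commute)
  show ?thesis
  proof (cases "even h")
    case True
    then have "p mod 4 = 1" using ph by presburger
    then show ?thesis using True L' mods residues by auto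
  next
    case False
    then have "p mod 4 = 3" using ph by presburger
    then show ?thesis using False L' mods residues by auto
  qed
qed

text \<open>The residues 1, 3, 7, 9 are closed under multiplication modulo 20, so the restriction
  passes from primes to all such divisors by splitting off one prime factor at a time.\<close>

lemma dvd_5_square_plus_4:
  fixes N x :: nat
  assumes "N dvd 5 * x\<^sup>2 + 4" "coprime N 10"
  shows "N mod 20 \<in> {1, 3, 7, 9}"
  using assms
proof (induction N rule: less_induct)
  case (less N)
  have "N \<noteq> 0" using less.prems(2) by (intro notI) simp
  show ?case
  proof (cases "N = 1")
    case False
    then obtain p where p: "prime p" "p dvd N" using prime_factor_nat by blast
    then obtain M where M: "N = p * M" by auto
    have cop: "coprime p 10" "coprime M 10" using less.prems(2) M by auto
    have "p \<noteq> 2" "p \<noteq> 5"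
      using coprime_common_divisor[OF cop(1), of 2] coprime_common_divisor[OF cop(1), of 5] by auto
    then have 1: "p mod 20 \<in> {1, 3, 7, 9}"
      using prime_dvd_5_square_plus_4[of p x] p less.prems(1) by (meson dvd_trans)
    have "M < N" using M \<open>N \<noteq> 0\<close> prime_gt_1_nat[OF p(1)] by auto
    then have 2: "M mod 20 \<in> {1, 3, 7, 9}"
      using less.IH[of M] less.prems(1) cop(2) M by (meson dvd_mult_right)
    have "N mod 20 = (p mod 20) * (M mod 20) mod 20" by (simp add: M mod_mult_eq)
    then show ?thesis using 1 2 by auto
  qed auto
qed

section \<open>Lucas numbers modulo small numbers\<close>

lemma lucas_fib: "lucas n + fib n = 2 * fib (Suc n)"
  by (induction n rule: lucas.induct) auto

text \<open>Replacing (x, y) by (x + y, x) negates the form x^2 - xy - y^2.\<close>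

lemma fib_Cassini_quadratic:
  "(int (fib (Suc n)))\<^sup>2 - int (fib (Suc n)) * int (fib n) - (int (fib n))\<^sup>2 = (-1) ^ n"
  by (induction n) (simp_all add: power2_eq_square algebra_simps)

text \<open>Complete the square: (2x - y)^2 - 5y^2 = 4(x^2 - xy - y^2), with x and y consecutive
  Fibonacci numbers.\<close>

lemma lucas_square_even:
  assumes "even n"
  shows "(lucas n)\<^sup>2 = 5 * (fib n)\<^sup>2 + 4"
proof -
  have L: "int (lucas n) = 2 * int (fib (Suc n)) - int (fib n)"
    using lucas_fib[of n] by linarith
  have "(int (lucas n))\<^sup>2 = 5 * (int (fib n))\<^sup>2 + 4 * (-1) ^ n"
    unfolding L fib_Cassini_quadratic[symmetric] by (simp add: power2_eq_square algebra_simps)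
  then have "int ((lucas n)\<^sup>2) = int (5 * (fib n)\<^sup>2 + 4)"
    using assms by simp
  then show ?thesis by (simp only: of_nat_eq_iff)
qed

lemma dvd_lucas_even:
  assumes "N dvd lucas k" "even k" "coprime N 10"
  shows "N mod 20 \<in> {1, 3, 7, 9}"
proof (rule dvd_5_square_plus_4)
  show "N dvd 5 * (fib k)\<^sup>2 + 4"
    using assms by (metis lucas_square_even dvd_power dvd_trans pos2)
qed fact

text \<open>Serves evaluation at numerals: \<open>gen_fib\<close> shifts its seeds (a, b) to (b, a +
  b) with a single recursive call, where \<open>lucas\<close> makes two.\<close>

lemma lucas_conv_gen_fib: "lucas n = gen_fib 2 1 n"
proof -
  have "gen_fib a b (Suc (Suc n)) = gen_fib a b (Suc n) + gen_fib a b n" for a b n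
    by (induction a b n rule: gen_fib.induct) auto
  then show ?thesis by (induction n rule: lucas.induct) (auto simp del: gen_fib.simps(3))
qed

lemma gen_fib_numeral:
  "gen_fib a b (numeral n) = gen_fib b (a + b) (pred_numeral n)"
  unfolding numeral_eq_Suc by (cases "pred_numeral n") simp_all

lemmas lucas_eval = lucas_conv_gen_fib gen_fib_numeral

text \<open>Two consecutive residues determine all later ones, so a return to the initial pair (2,
  1) after \<open>q\<close> steps makes \<open>q\<close> a period.\<close>

lemma lucas_mod_period:
  assumes "lucas q mod M = 2 mod M" "lucas (Suc q) mod M = 1 mod M"
  shows "lucas k mod M = lucas (k mod q) mod M"
proof -
  have step: "lucas (n + q) mod M = lucas n mod M" for n
    using assms by (induction n rule: lucas.induct) (auto intro: mod_add_cong)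
  have "lucas (n + m * q) mod M = lucas n mod M" for n m
  proof (induction m)
    case (Suc m)
    then show ?case using step[of "n + m * q"] by (simp add: algebra_simps)
  qed simp
  from this[of "k mod q" "k div q"] show ?thesis by simp
qed

lemma lucas_mod_25: "lucas k mod 25 = lucas (k mod 20) mod 25"
  by (rule lucas_mod_period) (simp_all add: lucas_eval)

lemma lucas_mod_16: "lucas k mod 16 = lucas (k mod 24) mod 16"
  by (rule lucas_mod_period) (simp_all add: lucas_eval)

lemma lucas_mod_11: "lucas k mod 11 = lucas (k mod 10) mod 11"
  by (rule lucas_mod_period) (simp_all add: lucas_eval)

lemma lucas_mod_7: "lucas k mod 7 = lucas (k mod 16) mod 7"
  by (rule lucas_mod_period) (simp_all add: lucas_eval)

lemma lucas_mod_3: "lucas k mod 3 = lucas (k mod 8) mod 3"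
  by (rule lucas_mod_period) (simp_all add: lucas_eval)

lemma odd_mod_cases:
  fixes k q :: nat
  assumes "odd k" "even q" "q > 0"
  shows "k mod q \<in> {..<q} \<and> odd (k mod q)"
  using assms by (simp add: dvd_mod_iff)

text \<open>The index is recorded with the value because later contradictions compare
  \<open>k mod 4\<close>, which both \<open>k mod 20\<close> and \<open>k mod 24\<close>
  determine.\<close>

lemma lucas_odd_mod_25:
  assumes "odd k"
  shows "(k mod 20, lucas k mod 25) \<in> {(1, 1), (3, 4), (5, 11), (7, 4), (9, 1), (11, 24), (13, 21),
    (15, 14), (17, 21), (19, 24)}"
proof -
  have "k mod 20 \<in> {1, 3, 5, 7, 9, 11, 13, 15, 17, 19}"
    using odd_mod_cases[OF assms, of 20]
    by (auto simp: lessThan_nat_numeral lessThan_Suc)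
  then show ?thesis unfolding lucas_mod_25[of k] by (elim insertE emptyE) (simp_all add: lucas_eval)
qed

lemma lucas_odd_mod_16:
  assumes "odd k"
  shows "(k mod 24, lucas k mod 16) \<in> {(1, 1), (3, 4), (5, 11), (7, 13), (9, 12), (11, 7), (13, 9),
    (15, 4), (17, 3), (19, 5), (21, 12), (23, 15)}"
proof -
  have "k mod 24 \<in> {1, 3, 5, 7, 9, 11, 13, 15, 17, 19, 21, 23}"
    using odd_mod_cases[OF assms, of 24]
    by (auto simp: lessThan_nat_numeral lessThan_Suc)
  then show ?thesis unfolding lucas_mod_16[of k] by (elim insertE emptyE) (simp_all add: lucas_eval)
qed

lemma lucas_odd_mod_11:
  assumes "odd k"
  shows "(k mod 10, lucas k mod 11) \<in> {(1, 1), (3, 4), (5, 0), (7, 7), (9, 10)}"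
proof -
  have "k mod 10 \<in> {1, 3, 5, 7, 9}"
    using odd_mod_cases[OF assms, of 10]
    by (auto simp: lessThan_nat_numeral lessThan_Suc)
  then show ?thesis unfolding lucas_mod_11[of k] by (elim insertE emptyE) (simp_all add: lucas_eval)
qed

lemma lucas_odd_not_dvd:
  assumes "odd k" "q \<in> {3, 5, 7, 8}"
  shows "\<not> q dvd lucas k"
proof -
  have "k mod 8 \<in> {1, 3, 5, 7}"
    using odd_mod_cases[OF assms(1), of 8]
    by (auto simp: lessThan_nat_numeral lessThan_Suc)
  then have 3: "lucas k mod 3 \<noteq> 0" unfolding lucas_mod_3[of k] by (elim insertE emptyE) (simp_all add: lucas_eval)
  have "k mod 16 \<in> {1, 3, 5, 7, 9, 11, 13, 15}"
    using odd_mod_cases[OF assms(1), of 16]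
    by (auto simp: lessThan_nat_numeral lessThan_Suc)
  then have 7: "lucas k mod 7 \<noteq> 0" unfolding lucas_mod_7[of k] by (elim insertE emptyE) (simp_all add: lucas_eval)
  have 5: "lucas k mod 5 \<noteq> 0"
    using lucas_odd_mod_25[OF assms(1)] mod_mod_cancel[of 5 25 "lucas k"] by auto
  have 8: "lucas k mod 8 \<noteq> 0"
    using lucas_odd_mod_16[OF assms(1)] mod_mod_cancel[of 8 16 "lucas k"] by auto
  show ?thesis using 3 5 7 8 assms(2) by (auto simp: mod_eq_0_iff_dvd)
qed

section \<open>Repunits\<close>

definition repunit :: "nat \<Rightarrow> nat" where
  "repunit m = (10 ^ m - 1) div 9"

lemma repdigit_eq: "repdigit d m = d * repunit m"
  by (simp add: repdigit_def repunit_def)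

lemma repunit_0 [simp]: "repunit 0 = 0"
  by (simp add: repunit_def)

lemma repunit_Suc [simp]: "repunit (Suc m) = 10 * repunit m + 1"
proof -
  have "9 * repunit n + 1 = 10 ^ n" for n
  proof -
    have "(10 :: nat) ^ n mod 9 = 1" using power_mod[of "10 :: nat" 9 n, symmetric] by simp
    then obtain y where "(10 :: nat) ^ n = 9 * y + 1" using mult_div_mod_eq[of 9 "10 ^ n"] by metis
    then show ?thesis by (simp add: repunit_def)
  qed
  from this[of m] this[of "Suc m"] show ?thesis by simp
qed

lemma repunit_Suc_mod: "repunit (Suc m) mod M = (10 * (repunit m mod M) + 1) mod M"
  by (metis mod_add_left_eq mod_mult_right_eq repunit_Suc)

lemma repunit_mod_100: "m \<ge> 2 \<Longrightarrow> repunit m mod 100 = 11"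
proof (induction m rule: dec_induct)
  case (step n)
  then show ?case unfolding repunit_Suc_mod by simp
qed (simp add: numeral_2_eq_2)

text \<open>111 is 7 modulo 8, and 7 is a fixed point of x -> 10x + 1 there.\<close>

lemma repunit_mod_8: "m \<ge> 3 \<Longrightarrow> repunit m mod 8 = 7"
proof (induction m rule: dec_induct)
  case (step n)
  then show ?case unfolding repunit_Suc_mod by simp
qed (simp add: numeral_3_eq_3)

lemma repunit_mod_11: "repunit m mod 11 = m mod 2"
proof (induction m)
  case (Suc m)
  then show ?case unfolding repunit_Suc_mod by (cases "even m") (simp_all add: mod_2_eq_odd)
qed simp

section \<open>Lucas numbers as products of repdigits\<close>

lemma prime_dvd_digits:
  fixes p :: nat
  assumes "prime p" "p dvd d1 * d2 * d3" "d1 \<in> {1..9}" "d2 \<in> {1..9}" "d3 \<in> {1..9}"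
  shows "p \<le> 9"
  using assms by (auto simp: prime_dvd_mult_iff dest!: dvd_imp_le)

text \<open>Every digit other than 1, 2, 4 has a divisor among 3, 5, 7, 8; the product is then a
  power of 2 not divisible by 8.\<close>

lemma digit_product_dvd_lucas_odd:
  assumes "odd k" "d1 * d2 * d3 dvd lucas k" "d1 \<in> {1..9}" "d2 \<in> {1..9}" "d3 \<in> {1..9}"
  shows "d1 * d2 * d3 \<in> {1, 2, 4}"
proof -
  have dig: "d \<in> {1, 2, 4}" if "d \<in> {1..9}" "d dvd lucas k" for d
  proof -
    have "d \<in> {1, 2, 3, 4, 5, 6, 7, 8, 9}" using that(1) by auto
    moreover have "\<not> q dvd d" if "q \<in> {3, 5, 7, 8}" for q
      using lucas_odd_not_dvd[OF assms(1) that] \<open>d dvd lucas k\<close> by (meson dvd_trans)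
    then have "\<not> 3 dvd d" "\<not> 5 dvd d" "\<not> 7 dvd d" "\<not> 8 dvd d" by auto
    ultimately show ?thesis by auto
  qed
  have "d1 dvd lucas k" "d2 dvd lucas k" "d3 dvd lucas k"
    using assms(2) by (meson dvd_mult_left dvd_mult_right)+
  then have "d1 \<in> {1, 2, 4}" "d2 \<in> {1, 2, 4}" "d3 \<in> {1, 2, 4}" using dig assms by auto
  moreover have "\<not> 8 dvd d1 * d2 * d3"
    using lucas_odd_not_dvd[OF assms(1), of 8] assms(2) by (meson dvd_trans insertCI)
  ultimately show ?thesis by auto
qed

lemma lucas_eq_digits:
  assumes "k \<ge> 1" "lucas k = d1 * d2 * d3" "d1 \<in> {1..9}" "d2 \<in> {1..9}" "d3 \<in> {1..9}"
  shows "lucas k \<in> {1, 3, 4, 7, 11, 18}"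
proof -
  have "d1 * d2 * d3 \<le> 9 * 9 * 9" using assms by (intro mult_mono) auto
  then have "lucas k \<le> 729" using assms(2) by simp
  \<comment> \<open>\<open>lucas 14\<close> is 843, the first Lucas number above 9^3 = 729.\<close>
  moreover have "lucas 14 \<le> lucas k" if "k \<ge> 14"
  proof -
    \<comment> \<open>Monotonicity starts at index 1 only, since
      \<open>lucas 0 > lucas 1\<close>.\<close>
    have "lucas (Suc m) \<le> lucas (Suc n)" if "m \<le> n" for m n
      using that by (rule lift_Suc_mono_le[rotated]) simp
    from this[of 13 "k - 1"] show ?thesis using that by simp
  qed
  ultimately have "k \<in> {..<14}" by (force simp: lucas_eval)
  then have "k \<in> {1, 2, 3, 4, 5, 6, 7, 8, 9, 10, 11, 12, 13}"
    using assms(1) by (auto simp: lessThan_nat_numeral lessThan_Suc)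
  moreover have "lucas k \<in> {1, 2, 4}" if "odd k"
    using digit_product_dvd_lucas_odd[OF that _ assms(3-5)] assms(2) by simp
  moreover have "\<not> p dvd lucas k" if "prime p" "p > 9" for p
    using prime_dvd_digits[of p d1 d2 d3] that assms by auto
  \<comment> \<open>These primes exclude the remaining even indices: L_8 = 47, L_10 = 3 * 41, L_12 =
    2 * 7 * 23.\<close>
  then have "\<not> 23 dvd lucas k" "\<not> 41 dvd lucas k" "\<not> 47 dvd lucas k" by simp_all
  ultimately show ?thesis by (elim insertE emptyE) (simp_all add: lucas_eval)
qed

lemma not_repunit_dvd_lucas_even:
  assumes "even k" "n \<ge> 2"
  shows "\<not> repunit n dvd lucas k"
proof
  assume "repunit n dvd lucas k"
  moreover have "coprime (repunit n) 10"
  proof (rule coprimeI)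
    fix c assume c: "c dvd repunit n" "c dvd 10"
    obtain j where "repunit n = 10 * j + 1" using assms(2) by (cases n) auto
    moreover have "c dvd 10 * j" using c(2) by (rule dvd_mult2)
    ultimately show "c dvd 1" using c(1) dvd_add_right_iff[of c "10 * j" 1] by simp
  qed
  ultimately have "repunit n mod 20 \<in> {1, 3, 7, 9}"
    using dvd_lucas_even assms(1) by blast
  moreover have "repunit n mod 20 = 11"
    using repunit_mod_100[OF assms(2)] mod_mod_cancel[of 20 100 "repunit n"] by simp
  ultimately show False by simp
qed

text \<open>\<open>A\<close>, \<open>B\<close>, \<open>C\<close> stand for the repunits of lengths
  \<open>l\<close>, \<open>m\<close>, \<open>n\<close>; the last hypothesis is what remains of
  \<open>l \<le> m\<close>.\<close>

lemma lucas_odd_eq_repunits_cases: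
  assumes k: "odd k" and eq: "lucas k = D * (A * B * C)" and D: "D \<in> {1, 2, 4}"
    and A: "A = 1 \<or> A mod 100 = 11" and B: "B = 1 \<or> B mod 100 = 11" and C: "C mod 100 = 11"
    and AB: "B = 1 \<Longrightarrow> A = 1"
  shows "D = 1 \<and> A = 1"
proof -
  have split: "x mod 25 = 11 \<and> x mod 4 = 3" if "x mod 100 = 11" for x :: nat
    using that mod_mod_cancel[of 25 100 x] mod_mod_cancel[of 4 100 x] by simp
  have A': "A = 1 \<or> (A mod 25 = 11 \<and> A mod 4 = 3)" using A split by blast
  have B': "B = 1 \<or> (B mod 25 = 11 \<and> B mod 4 = 3)" using B split by blast
  have C': "C mod 25 = 11 \<and> C mod 4 = 3" using C split by blast
  define P where "P = A * B * C"
  have P25: "P mod 25 = ((A mod 25) * (B mod 25) mod 25) * (C mod 25) mod 25"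
    by (simp only: P_def mod_simps)
  have P4: "P mod 4 = ((A mod 4) * (B mod 4) mod 4) * (C mod 4) mod 4"
    by (simp only: P_def mod_simps)
  consider "A = 1" "B = 1" | "A = 1" "B \<noteq> 1" | "A \<noteq> 1" "B \<noteq> 1" using AB by blast
  \<comment> \<open>One, two or three factors congruent to 11 give 11, 21, 6 modulo 25 and 3, 1, 3
    modulo 4.\<close>
  then have P: "(A = 1 \<and> P mod 25 = 11 \<and> P mod 4 = 3) \<or> (A = 1 \<and> P mod 25 = 21 \<and> P mod 4 = 1) \<or>
    (P mod 25 = 6 \<and> P mod 4 = 3)"
  proof cases
    case 1
    then show ?thesis using C' by (simp add: P_def)
  next
    case 2
    then show ?thesis using B' C' P25 P4 by simp
  next
    case 3
    then show ?thesis using A' B' C' P25 P4 by simp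
  qed
  have eq': "lucas k = D * P" using eq by (simp add: P_def)
  have L25: "(k mod 20, lucas k mod 25) \<in> {(1, 1), (3, 4), (5, 11), (7, 4), (9, 1), (11, 24), (13, 21),
    (15, 14), (17, 21), (19, 24)}" by (rule lucas_odd_mod_25[OF k])
  have L16: "(k mod 24, lucas k mod 16) \<in> {(1, 1), (3, 4), (5, 11), (7, 13), (9, 12), (11, 7), (13, 9),
    (15, 4), (17, 3), (19, 5), (21, 12), (23, 15)}" by (rule lucas_odd_mod_16[OF k])
  consider "D = 1" | "D = 2" | "D = 4" using D by auto
  then show ?thesis
  proof cases
    case 1
    have "A = 1"
    proof (rule ccontr)
      assume "A \<noteq> 1"
      then have "P mod 25 = 6" using P by blast
      then show False using L25 1 eq' by auto
    qed
    with 1 show ?thesis by simp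
  next
    case 2
    have "P mod 4 = 1 \<or> P mod 4 = 3" using P by auto
    then have "lucas k mod 4 = 2" using 2 eq' by presburger
    moreover have "lucas k mod 4 \<noteq> 2" using L16 mod_mod_cancel[of 4 16 "lucas k"] by auto
    ultimately show ?thesis by simp
  next
    case 3
    \<comment> \<open>Only 24 occurs at odd indices. It forces \<open>k mod 4 = 3\<close>, while the
      residue 12 modulo 16 forces \<open>k mod 4 = 1\<close>.\<close>
    have "lucas k mod 25 \<in> {19, 9, 24}"
      using P 3 eq' mod_mult_right_eq[of 4 P 25] by auto
    then have *: "k mod 20 \<in> {11, 19}" "lucas k mod 25 = 24" using L25 by auto
    then have "(4 * (P mod 25)) mod 25 = 24" using 3 eq' by (simp add: mod_mult_right_eq)
    then have "P mod 4 = 3" using P by auto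
    then have "lucas k mod 16 = 12" using 3 eq' by presburger
    then have "k mod 24 = 9 \<or> k mod 24 = 21" using L16 by auto
    then have "k mod 4 = 1" using mod_mod_cancel[of 4 24 k] by auto
    moreover have "k mod 4 = 3" using *(1) mod_mod_cancel[of 4 20 k] by auto
    ultimately show ?thesis by simp
  qed
qed

text \<open>For \<open>n \<ge> 3\<close>, the residue 11 modulo 25 forces
  \<open>k mod 4 = 1\<close>, but the residue 7 modulo 8 forces \<open>k mod 4 = 3\<close>.\<close>

lemma lucas_odd_eq_repunit:
  assumes "odd k" "lucas k = repunit n" "n \<ge> 2"
  shows "lucas k = 11"
proof (cases "n = 2")
  case True
  then show ?thesis using assms by (simp add: numeral_2_eq_2)
next
  case False
  have "lucas k mod 25 = 11"
    using assms repunit_mod_100[of n] mod_mod_cancel[of 25 100 "repunit n"] by simp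
  then have "k mod 20 = 5" using lucas_odd_mod_25[OF assms(1)] by auto
  have "lucas k mod 8 = 7" using assms False repunit_mod_8[of n] by simp
  then have "k mod 24 = 11 \<or> k mod 24 = 23"
    using lucas_odd_mod_16[OF assms(1)] mod_mod_cancel[of 8 16 "lucas k"] by auto
  then have "k mod 4 = 3" using mod_mod_cancel[of 4 24 k] by auto
  moreover have "k mod 4 = 1" using \<open>k mod 20 = 5\<close> mod_mod_cancel[of 4 20 k] by auto
  ultimately show ?thesis by simp
qed

text \<open>The residue 21 modulo 25 forces \<open>k mod 10\<close> to be 3 or 7, so
  \<open>lucas k\<close> is 4 or 7 modulo 11, whereas repunits are 0 or 1 there.\<close>

lemma lucas_odd_neq_two_repunits:
  assumes "odd k" "m \<ge> 2" "n \<ge> 2"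
  shows "lucas k \<noteq> repunit m * repunit n"
proof
  assume eq: "lucas k = repunit m * repunit n"
  have "lucas k mod 25 = (repunit m mod 25) * (repunit n mod 25) mod 25"
    by (simp add: eq mod_mult_eq)
  also have "\<dots> = 21"
    using assms repunit_mod_100[of m] mod_mod_cancel[of 25 100 "repunit m"]
      repunit_mod_100[of n] mod_mod_cancel[of 25 100 "repunit n"] by simp
  finally have "k mod 20 = 13 \<or> k mod 20 = 17" using lucas_odd_mod_25[OF assms(1)] by auto
  then have "k mod 10 = 3 \<or> k mod 10 = 7" using mod_mod_cancel[of 10 20 k] by auto
  moreover have "lucas k mod 11 = (repunit m mod 11) * (repunit n mod 11) mod 11"
    by (simp add: eq mod_mult_eq)
  then have "lucas k mod 11 \<in> {0, 1}"
    unfolding repunit_mod_11 by (cases "even m"; cases "even n") (auto simp: mod_2_eq_odd)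
  ultimately show False using lucas_odd_mod_11[OF assms(1)] by auto
qed

lemma lucas_eq_repdigits:
  assumes k: "k \<ge> 1" and d: "d1 \<in> {1..9}" "d2 \<in> {1..9}" "d3 \<in> {1..9}"
    and lmn: "1 \<le> l" "l \<le> m" "m \<le> n"
    and eq: "lucas k = repdigit d1 l * repdigit d2 m * repdigit d3 n"
  shows "lucas k \<in> {1, 3, 4, 7, 11, 18}"
proof -
  define D where "D = d1 * d2 * d3"
  have eq': "lucas k = D * (repunit l * repunit m * repunit n)"
    by (simp add: eq repdigit_eq D_def mult_ac)
  show ?thesis
  proof (cases "n = 1")
    case True
    then have "l = 1" "m = 1" using lmn by auto
    then show ?thesis using lucas_eq_digits[OF k _ d] eq' True by (simp add: D_def)
  next
    case False
    then have n: "n \<ge> 2" using lmn by simp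
    have odd: "odd k" using not_repunit_dvd_lucas_even[OF _ n, of k] eq' by (metis dvd_mult dvd_triv_right)
    have D: "D \<in> {1, 2, 4}"
      unfolding D_def using eq' by (intro digit_product_dvd_lucas_odd[OF odd _ d]) (simp add: D_def)
    have R: "repunit j = 1 \<or> repunit j mod 100 = 11" if "j \<ge> 1" for j
      using that repunit_mod_100[of j] by (cases "j = 1") auto
    have R1: "repunit l = 1" if "repunit m = 1"
    proof -
      have "m = 1" using that lmn repunit_mod_100[of m] by (cases "m \<ge> 2") auto
      then show ?thesis using lmn by simp
    qed
    have "1 \<le> m" using lmn by simp
    have "D = 1 \<and> repunit l = 1"
      by (rule lucas_odd_eq_repunits_cases[OF odd eq' D R[OF lmn(1)] R[OF \<open>1 \<le> m\<close>]
        repunit_mod_100[OF n] R1])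
    then have eq2: "lucas k = repunit m * repunit n" using eq' by simp
    show ?thesis
    proof (cases "m = 1")
      case True
      then show ?thesis using lucas_odd_eq_repunit[OF odd _ n] eq2 by simp
    next
      case False
      then show ?thesis using lucas_odd_neq_two_repunits[OF odd _ n, of m] eq2 lmn by simp
    qed
  qed
qed

theorem theorem4p3:
  fixes k :: nat
  assumes "k \<ge> 1"
  shows "(\<exists>d1 d2 d3 l m n :: nat.
            1 \<le> d1 \<and> d1 \<le> 9 \<and> 1 \<le> d2 \<and> d2 \<le> 9 \<and> 1 \<le> d3 \<and> d3 \<le> 9 \<and>
            1 \<le> l \<and> l \<le> m \<and> m \<le> n \<and>
            lucas k = repdigit d1 l * repdigit d2 m * repdigit d3 n)
         \<longleftrightarrow> lucas k \<in> {1, 3, 4, 7, 11, 18}" (is "?L \<longleftrightarrow> ?R")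
proof
  assume ?L
  then obtain d1 d2 d3 l m n where
    "d1 \<in> {1..9}" "d2 \<in> {1..9}" "d3 \<in> {1..9}" "1 \<le> l" "l \<le> m" "m \<le> n"
    "lucas k = repdigit d1 l * repdigit d2 m * repdigit d3 n"
    by auto
  then show ?R by (rule lucas_eq_repdigits[OF assms])
next
  \<comment> \<open>With \<open>l = m = 1\<close> the ordering constraints reduce to
    \<open>n \<ge> 1\<close>; only the value 11 needs a longer repdigit.\<close>
  have wit: ?L
    if "lucas k = repdigit d1 1 * repdigit d2 1 * repdigit d3 n"
      "d1 \<in> {1..9}" "d2 \<in> {1..9}" "d3 \<in> {1..9}" "n \<ge> 1" for d1 d2 d3 n
    using that by (meson atLeastAtMost_iff order_refl)
  assume ?R
  then consider "lucas k \<in> {1..9}" | "lucas k = 11" | "lucas k = 18"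
    by auto
  then show ?L
  proof cases
    case 1
    then show ?thesis by (intro wit[of 1 1 "lucas k" 1]) (simp_all add: repdigit_eq)
  next
    case 2
    then show ?thesis by (intro wit[of 1 1 1 2]) (simp_all add: repdigit_eq numeral_2_eq_2)
  next
    case 3
    then show ?thesis by (intro wit[of 1 2 9 1]) (simp_all add: repdigit_eq)
  qed
qed

end
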